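(* Let $d_1,d_2\in\mathbb{N}$, $1\leq k\leq d_1$, and let $\Phi:\mathbb{M}_{d_1}\to\mathbb{M}_{d_2}$ be a $k$-positive linear map. Then the following conditions are equivalent: (i) $\Phi$ is $k$-entanglement breaking. (ii) For every complete set of matrix units $\{F_{ij}\}_{i,j=1}^{d_1}\subseteq\mathbb{M}_{d_1}$, every principal $(k\times k)$-block submatrix $C^F_{\Phi(i_1,\dots,i_k)}$ (with $i_1,\dots,i_k\in\{1,\dots,d_1\}$) of the Choi matrix $C^F_\Phi$ is separable. (iii) For every complete set of matrix units $\{F_{ij}\}_{i,j=1}^{d_1}\subseteq\mathbb{M}_{d_1}$, the principal $(k\times k)$-block submatrix $C^F_{\Phi(1,2,\dots,k)}$ of the Choi matrix $C^F_\Phi$ is separable.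
   Context: $\mathbb{M}_d$ is the algebra of complex $d\times d$ matrices; a superscript $+$ denotes the cone of positive semidefinite matrices. A linear map $\Phi:\mathbb{M}_{d_1}\to\mathbb{M}_{d_2}$ is $k$-positive if $\mathrm{id}_k\otimes\Phi$ maps positive semidefinite matrices to positive semidefinite matrices. $X\in(\mathbb{M}_{m}\otimes\mathbb{M}_{n})^+$ is separable if $X=\sum_i A_i\otimes B_i$ (finite sum) with $A_i\in\mathbb{M}_m^+$, $B_i\in\mathbb{M}_n^+$. $\Phi$ is $k$-entanglement breaking if it is $k$-positive and $(\mathrm{id}_k\otimes\Phi)(X)$ is separable for every $X\in(\mathbb{M}_k\otimes\mathbb{M}_{d_1})^+$. A complete set of matrix units in $\mathbb{M}_{d_1}$ is a family $F_{ij}=|f_i\rangle\langle f_j|$, $1\le i,j\le d_1$, where $\{f_i\}_{i=1}^{d_1}$ is an orthonormal basis of $\mathbb{C}^{d_1}$ and $|x\rangle\langle y|(z)=x\langle y,z\rangle$. The Choi matrix with respect to it is $C^F_\Phi=\sum_{i,j=1}^{d_1}F_{ij}\otimes\Phi(F_{ij})$. For $i_1,\dots,i_k\in\{1,\dots,d_1\}$, the principal $(k\times k)$-block submatrix of $C^F_\Phi$ is $C^F_{\Phi(i_1,\dots,i_k)}=\sum_{p,q=1}^k E^{(k)}_{pq}\otimes\Phi(F_{i_pi_q})\in\mathbb{M}_k\otimes\mathbb{M}_{d_2}$, where $E^{(k)}_{pq}$ are the standard matrix units of $\mathbb{M}_k$. *)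

theory Defs
  imports "Jordan_Normal_Form.Schur_Decomposition"
begin

text \<open>
  The algebra of complex \<open>d \<times> d\<close> matrices is \<open>carrier_mat d d\<close>, and indices start at \<open>0\<close>.
  The tensor product of the \<open>m \<times> m\<close> and the \<open>n \<times> n\<close> matrices is identified with
  \<open>carrier_mat (m * n) (m * n)\<close> through the Kronecker product, the pair of indices \<open>(p, i)\<close>
  being encoded as \<open>p * n + i\<close>.
\<close>

definition kronecker :: "complex mat \<Rightarrow> complex mat \<Rightarrow> complex mat" where
  "kronecker A B = mat (dim_row A * dim_row B) (dim_col A * dim_col B)
     (\<lambda>(r, c). A $$ (r div dim_row B, c div dim_col B) * B $$ (r mod dim_row B, c mod dim_col B))"

abbreviation sum_of_mats :: "nat \<Rightarrow> ('i \<Rightarrow> complex mat) \<Rightarrow> 'i set \<Rightarrow> complex mat" where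
  "sum_of_mats n \<equiv> finsum (module_mat TYPE(complex) n n)"

definition std_unit :: "nat \<Rightarrow> nat \<Rightarrow> nat \<Rightarrow> complex mat" where
  "std_unit k p q = mat k k (\<lambda>(i, j). if i = p \<and> j = q then 1 else 0)"

text \<open>
  On complex numbers \<open>0 \<le> z\<close> says that \<open>z\<close> is real and nonnegative, so that Hermitian symmetry
  of \<open>A\<close> need not be required separately.
\<close>

definition psd :: "nat \<Rightarrow> complex mat \<Rightarrow> bool" where
  "psd n A \<longleftrightarrow> A \<in> carrier_mat n n \<and> (\<forall>v \<in> carrier_vec n. 0 \<le> (A *\<^sub>v v) \<bullet>c v)"

abbreviation linear_on_mats :: "nat \<Rightarrow> nat \<Rightarrow> (complex mat \<Rightarrow> complex mat) \<Rightarrow> bool" where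
  "linear_on_mats d1 d2 \<equiv>
     linear_map class_ring (module_mat TYPE(complex) d1 d1) (module_mat TYPE(complex) d2 d2)"

definition mat_block :: "nat \<Rightarrow> complex mat \<Rightarrow> nat \<Rightarrow> nat \<Rightarrow> complex mat" where
  "mat_block d X p q = mat d d (\<lambda>(i, j). X $$ (p * d + i, q * d + j))"

text \<open>
  The map \<open>id\<^sub>k \<otimes> \<Phi>\<close>, given by writing \<open>X = \<Sum>p,q. E\<^sub>p\<^sub>q \<otimes> X\<^sub>p\<^sub>q\<close>; see
  \<open>ampliation_kronecker\<close> below for its value on elementary tensors.
\<close>

definition ampliation ::
    "nat \<Rightarrow> nat \<Rightarrow> nat \<Rightarrow> (complex mat \<Rightarrow> complex mat) \<Rightarrow> complex mat \<Rightarrow> complex mat" where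
  "ampliation k d1 d2 \<Phi> X =
     sum_of_mats (k * d2) (\<lambda>(p, q). kronecker (std_unit k p q) (\<Phi> (mat_block d1 X p q)))
       ({..<k} \<times> {..<k})"

definition k_positive :: "nat \<Rightarrow> nat \<Rightarrow> nat \<Rightarrow> (complex mat \<Rightarrow> complex mat) \<Rightarrow> bool" where
  "k_positive k d1 d2 \<Phi> \<longleftrightarrow> (\<forall>X. psd (k * d1) X \<longrightarrow> psd (k * d2) (ampliation k d1 d2 \<Phi> X))"

definition separable :: "nat \<Rightarrow> nat \<Rightarrow> complex mat \<Rightarrow> bool" where
  "separable m n X \<longleftrightarrow> psd (m * n) X \<and>
     (\<exists>(r::nat) A B. (\<forall>i<r. psd m (A i) \<and> psd n (B i)) \<and>
        X = sum_of_mats (m * n) (\<lambda>i. kronecker (A i) (B i)) {..<r})"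

definition k_entanglement_breaking ::
    "nat \<Rightarrow> nat \<Rightarrow> nat \<Rightarrow> (complex mat \<Rightarrow> complex mat) \<Rightarrow> bool" where
  "k_entanglement_breaking k d1 d2 \<Phi> \<longleftrightarrow> k_positive k d1 d2 \<Phi> \<and>
     (\<forall>X. psd (k * d1) X \<longrightarrow> separable k d2 (ampliation k d1 d2 \<Phi> X))"

definition ketbra :: "complex vec \<Rightarrow> complex vec \<Rightarrow> complex mat" where
  "ketbra x y = mat (dim_vec x) (dim_vec y) (\<lambda>(i, j). x $ i * conjugate (y $ j))"

definition orthonormal_basis :: "nat \<Rightarrow> (nat \<Rightarrow> complex vec) \<Rightarrow> bool" where
  "orthonormal_basis d f \<longleftrightarrow>
     vectorspace.basis class_ring (module_vec TYPE(complex) d) (f ` {..<d}) \<and>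
     (\<forall>i<d. \<forall>j<d. f i \<bullet>c f j = (if i = j then 1 else 0))"

definition matrix_units :: "nat \<Rightarrow> (nat \<Rightarrow> nat \<Rightarrow> complex mat) \<Rightarrow> bool" where
  "matrix_units d F \<longleftrightarrow>
     (\<exists>f. orthonormal_basis d f \<and> (\<forall>i<d. \<forall>j<d. F i j = ketbra (f i) (f j)))"

definition choi_matrix ::
    "nat \<Rightarrow> nat \<Rightarrow> (nat \<Rightarrow> nat \<Rightarrow> complex mat) \<Rightarrow> (complex mat \<Rightarrow> complex mat) \<Rightarrow> complex mat" where
  "choi_matrix d1 d2 F \<Phi> =
     sum_of_mats (d1 * d2) (\<lambda>(i, j). kronecker (F i j) (\<Phi> (F i j))) ({..<d1} \<times> {..<d1})"

text \<open>
  The principal \<open>k \<times> k\<close> block submatrix of the Choi matrix at the rows and columns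
  \<open>s 0, \<dots>, s (k - 1)\<close>, which need not be distinct nor ordered.  Blocks are taken relative to the
  basis underlying \<open>F\<close>: the \<open>(i, j)\<close> block is \<open>\<Phi> (F i j)\<close>.
\<close>

definition choi_principal_block ::
    "nat \<Rightarrow> nat \<Rightarrow> (nat \<Rightarrow> nat \<Rightarrow> complex mat) \<Rightarrow> (complex mat \<Rightarrow> complex mat) \<Rightarrow> (nat \<Rightarrow> nat) \<Rightarrow>
     complex mat" where
  "choi_principal_block k d2 F \<Phi> s =
     sum_of_mats (k * d2) (\<lambda>(p, q). kronecker (std_unit k p q) (\<Phi> (F (s p) (s q))))
       ({..<k} \<times> {..<k})"


lemma kronecker_carrier [intro]:
  "A \<in> carrier_mat m m \<Longrightarrow> B \<in> carrier_mat n n \<Longrightarrow> kronecker A B \<in> carrier_mat (m * n) (m * n)"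
  by (auto simp: kronecker_def)

lemma sum_of_mats_carrier_index:
  assumes "finite I" "\<And>x. x \<in> I \<Longrightarrow> f x \<in> carrier_mat n n"
  shows "sum_of_mats n f I \<in> carrier_mat n n \<and>
         (\<forall>i<n. \<forall>j<n. sum_of_mats n f I $$ (i, j) = (\<Sum>x\<in>I. f x $$ (i, j)))"
proof -
  interpret abelian_group "module_mat TYPE(complex) n n"
    by (rule abelian_group_mat)
  show ?thesis using assms
  proof (induction I rule: finite_induct)
    case empty
    show ?case by (auto simp: module_mat_simps)
  next
    case (insert x I)
    have "sum_of_mats n f (insert x I) = f x + sum_of_mats n f I"
      using insert by (subst finsum_insert) (auto simp: module_mat_simps)
    then show ?case using insert by auto
  qed
qed

lemma ampliation_kronecker:
  assumes lin: "linear_on_mats d1 d2 \<Phi>"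
    and A: "A \<in> carrier_mat k k" and B: "B \<in> carrier_mat d1 d1"
  shows "ampliation k d1 d2 \<Phi> (kronecker A B) = kronecker A (\<Phi> B)"
proof -
  interpret linear_map class_ring "module_mat TYPE(complex) d1 d1" "module_mat TYPE(complex) d2 d2" \<Phi>
    by (rule lin)
  have Pc: "\<Phi> Y \<in> carrier_mat d2 d2" if "Y \<in> carrier_mat d1 d1" for Y
    using f_hom that by (auto simp: LinearCombinations.module_hom_def module_mat_simps)
  have Ps: "\<Phi> (c \<cdot>\<^sub>m Y) = c \<cdot>\<^sub>m \<Phi> Y" if "Y \<in> carrier_mat d1 d1" for c Y
    using f_smult[of c Y] that by (simp add: module_mat_simps class_ring_simps)
  have lt: "p * d + i < k * d" if "p < k" "i < d" for p i d :: nat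
  proof -
    have "p * d + i < (p + 1) * d" using that by simp
    also have "\<dots> \<le> k * d" using that by (intro mult_right_mono) auto
    finally show ?thesis .
  qed
  have blk: "mat_block d1 (kronecker A B) p q = A $$ (p, q) \<cdot>\<^sub>m B" if "p < k" "q < k" for p q
    using A B that lt by (intro eq_matI) (auto simp: mat_block_def kronecker_def)
  let ?f = "\<lambda>(p, q). kronecker (std_unit k p q) (\<Phi> (mat_block d1 (kronecker A B) p q))"
  have fc: "?f x \<in> carrier_mat (k * d2) (k * d2)" for x
    by (cases x) (auto intro!: kronecker_carrier Pc simp: std_unit_def mat_block_def)
  note S = sum_of_mats_carrier_index[of "{..<k} \<times> {..<k}" ?f "k * d2", OF _ fc]
  have KC: "kronecker A (\<Phi> B) \<in> carrier_mat (k * d2) (k * d2)"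
    using A Pc[OF B] by auto
  show ?thesis
  proof (rule eq_matI)
    fix i j assume "i < dim_row (kronecker A (\<Phi> B))" "j < dim_col (kronecker A (\<Phi> B))"
    then have ij: "i < k * d2" "j < k * d2" using KC by auto
    then have d2: "d2 > 0" by (cases d2) auto
    have dv: "i div d2 < k" "j div d2 < k" "i mod d2 < d2" "j mod d2 < d2"
      using ij d2 by (auto simp: less_mult_imp_div_less)
    have entry: "?f x $$ (i, j) =
        (if x = (i div d2, j div d2) then A $$ x * \<Phi> B $$ (i mod d2, j mod d2) else 0)"
      if xk: "x \<in> {..<k} \<times> {..<k}" for x
    proof -
      obtain p q where x: "x = (p, q)" "p < k" "q < k" using xk by (cases x) auto
      have "?f x = kronecker (std_unit k p q) (A $$ (p, q) \<cdot>\<^sub>m \<Phi> B)"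
        using x by (simp add: blk Ps[OF B])
      then show ?thesis
        using x(1) ij dv Pc[OF B] by (auto simp: kronecker_def std_unit_def)
    qed
    have "ampliation k d1 d2 \<Phi> (kronecker A B) $$ (i, j) =
        (\<Sum>x\<in>{..<k} \<times> {..<k}. ?f x $$ (i, j))"
      using S ij by (simp add: ampliation_def)
    also have "\<dots> = A $$ (i div d2, j div d2) * \<Phi> B $$ (i mod d2, j mod d2)"
      using dv by (simp add: entry sum.delta del: split_paired_All cong: sum.cong)
    also have "\<dots> = kronecker A (\<Phi> B) $$ (i, j)"
      using ij A Pc[OF B] by (auto simp: kronecker_def)
    finally show "ampliation k d1 d2 \<Phi> (kronecker A B) $$ (i, j) = kronecker A (\<Phi> B) $$ (i, j)" .
  qed (use S KC in \<open>auto simp: ampliation_def\<close>)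
qed

lemma choi_principal_block_full:
  "choi_principal_block d1 d2 (std_unit d1) \<Phi> (\<lambda>p. p) = choi_matrix d1 d2 (std_unit d1) \<Phi>"
  by (simp add: choi_principal_block_def choi_matrix_def)

lemma orthonormal_basisI:
  assumes car: "\<And>i. i < d \<Longrightarrow> f i \<in> carrier_vec d"
    and orth: "\<And>i j. i < d \<Longrightarrow> j < d \<Longrightarrow> f i \<bullet>c f j = (if i = j then 1 else 0)"
  shows "orthonormal_basis d f"
proof -
  interpret vec_space "TYPE(complex)" d .
  let ?A = "f ` {..<d}"
  have inj: "inj_on f {..<d}"
  proof (rule inj_onI)
    fix i j assume "i \<in> {..<d}" "j \<in> {..<d}" "f i = f j"
    then show "i = j" using orth[of i i] orth[of j i] by (auto split: if_splits)
  qed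
  have Ac: "?A \<subseteq> carrier_vec d" using car by auto
  have "lin_indpt ?A"
  proof (rule finite_lin_indpt2)
    fix a assume z: "lincomb a ?A = 0\<^sub>v d"
    show "\<forall>v\<in>?A. a v = 0"
    proof
      fix v assume v: "v \<in> ?A"
      then obtain j where j: "j < d" "v = f j" by auto
      have fj: "f j \<in> carrier_vec d" using car j by auto
      have "0 = lincomb a ?A \<bullet>c f j" using fj unfolding z by simp
      also have "\<dots> = (\<Sum>l<d. (\<Sum>x\<in>?A. a x * x $ l) * conjugate (f j $ l))"
        using fj by (auto simp: scalar_prod_def lincomb_index[OF _ Ac] atLeast0LessThan intro!: sum.cong)
      also have "\<dots> = (\<Sum>x\<in>?A. a x * (\<Sum>l<d. x $ l * conjugate (f j $ l)))"
        unfolding sum_distrib_left sum_distrib_right by (subst sum.swap) (simp add: mult.assoc)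
      also have "\<dots> = (\<Sum>x\<in>?A. a x * (x \<bullet>c f j))"
        using fj by (intro sum.cong refl) (auto simp: scalar_prod_def atLeast0LessThan)
      also have "\<dots> = (\<Sum>i<d. a (f i) * (f i \<bullet>c f j))"
        using inj by (subst sum.reindex) auto
      also have "\<dots> = (\<Sum>i<d. if i = j then a (f i) else 0)"
        using j by (intro sum.cong refl) (auto simp: orth)
      also have "\<dots> = a v" using j by simp
      finally show "a v = 0" by simp
    qed
  qed (use Ac in auto)
  then have "basis ?A"
    using Ac inj by (intro dim_li_is_basis) (auto simp: card_image dim_is_n)
  then show ?thesis using orth by (simp add: orthonormal_basis_def)
qed

end

theory Submission
  imports Defs
begin

text \<open>
  Both block conditions are special cases of \<open>k\<close>-entanglement breaking, because a principal
  block is itself an image under \<open>id\<^sub>k \<otimes> \<Phi>\<close>: with \<open>w = \<Sum>\<^sub>p e\<^sub>p \<otimes> f\<^bsub>s p\<^esub>\<close>, applying the map to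
  the positive matrix \<open>|w\<rangle>\<langle>w|\<close> produces the block at \<open>s\<close>
  (\<open>choi_principal_block_eq_ampliation\<close>).

  The substance is that the leading blocks alone suffice, provided that every orthonormal basis is
  tested.  A positive semidefinite \<open>X\<close> is a sum of rank-one matrices \<open>|w\<rangle>\<langle>w|\<close>
  (\<open>psd_sum_of_ketbras\<close>), and separable matrices are closed under sums (\<open>separable_sum\<close>), so it
  is enough to treat \<open>X = |w\<rangle>\<langle>w|\<close>.  Write \<open>w = \<Sum>\<^sub>p e\<^sub>p \<otimes> v\<^sub>p\<close>.  Only \<open>k\<close> vectors \<open>v\<^sub>p\<close> occur, so
  they lie in the span of the first \<open>k\<close> members of some orthonormal basis \<open>f\<close>
  (\<open>adapted_orthonormal_basis\<close>; this needs \<open>k \<le> d1\<close>): \<open>v\<^sub>p = \<Sum>\<^sub>l a\<^sub>p\<^sub>l f\<^sub>l\<close> with \<open>l < k\<close>.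
  By linearity, with \<open>a = (a\<^sub>p\<^sub>l)\<close>,
  \<open>(id\<^sub>k \<otimes> \<Phi>)(|w\<rangle>\<langle>w|) = (a \<otimes> 1) C (a \<otimes> 1)\<^sup>*\<close>, where \<open>C\<close> is the leading block for the
  matrix units of \<open>f\<close>.  If \<open>C = \<Sum>\<^sub>t A\<^sub>t \<otimes> B\<^sub>t\<close> is separable, then the right-hand side is
  \<open>\<Sum>\<^sub>t (a A\<^sub>t a\<^sup>*) \<otimes> B\<^sub>t\<close>, which is separable again (\<open>ampliation_ketbra_separable\<close>).
\<close>

section \<open>Sums of matrices and rank-one matrices\<close>

lemma sum_of_mats_carrier:
  "finite I \<Longrightarrow> (\<And>x. x \<in> I \<Longrightarrow> f x \<in> carrier_mat n n) \<Longrightarrow> sum_of_mats n f I \<in> carrier_mat n n"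
  by (simp add: sum_of_mats_carrier_index)

lemma sum_of_mats_index:
  "finite I \<Longrightarrow> (\<And>x. x \<in> I \<Longrightarrow> f x \<in> carrier_mat n n) \<Longrightarrow> i < n \<Longrightarrow> j < n \<Longrightarrow>
    sum_of_mats n f I $$ (i, j) = (\<Sum>x\<in>I. f x $$ (i, j))"
  by (simp add: sum_of_mats_carrier_index)

lemma eq_sum_of_matsI:
  assumes "finite I" "\<And>x. x \<in> I \<Longrightarrow> f x \<in> carrier_mat n n" "X \<in> carrier_mat n n"
    and "\<And>i j. i < n \<Longrightarrow> j < n \<Longrightarrow> X $$ (i, j) = (\<Sum>x\<in>I. f x $$ (i, j))"
  shows "X = sum_of_mats n f I"
  using assms sum_of_mats_carrier[of I f n] by (intro eq_matI) (auto simp: sum_of_mats_index)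

lemma ketbra_carrier: "x \<in> carrier_vec d \<Longrightarrow> y \<in> carrier_vec d \<Longrightarrow> ketbra x y \<in> carrier_mat d d"
  by (auto simp: ketbra_def)

lemma ketbra_index:
  "x \<in> carrier_vec d \<Longrightarrow> y \<in> carrier_vec d \<Longrightarrow> i < d \<Longrightarrow> j < d \<Longrightarrow> ketbra x y $$ (i, j) = x $ i * cnj (y $ j)"
  by (auto simp: ketbra_def)

section \<open>Positive semidefinite matrices\<close>

text \<open>
  Ranging over all functions \<open>g\<close> instead of vectors of length \<open>n\<close> removes the carrier condition,
  so test vectors can be written down and perturbed without typing obligations.
\<close>

lemma psd_iff_quadratic_form:
  "psd n A \<longleftrightarrow> A \<in> carrier_mat n n \<and>
     (\<forall>g. 0 \<le> (\<Sum>a<n. \<Sum>b<n. A $$ (a, b) * g b * cnj (g a)))"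
proof -
  have form: "(A *\<^sub>v v) \<bullet>c v = (\<Sum>a<n. \<Sum>b<n. A $$ (a, b) * v $ b * cnj (v $ a))"
    if "A \<in> carrier_mat n n" "v \<in> carrier_vec n" for v
    using that by (auto simp: scalar_prod_def atLeast0LessThan sum_distrib_right intro!: sum.cong)
  have fun_form: "(\<Sum>a<n. \<Sum>b<n. A $$ (a, b) * g b * cnj (g a)) = (A *\<^sub>v vec n g) \<bullet>c vec n g"
    if "A \<in> carrier_mat n n" for g
    by (subst form[OF that]) auto
  show ?thesis
  proof (intro iffI conjI allI)
    assume "psd n A"
    then show "A \<in> carrier_mat n n" by (simp add: psd_def)
    fix g
    show "0 \<le> (\<Sum>a<n. \<Sum>b<n. A $$ (a, b) * g b * cnj (g a))"
      using \<open>psd n A\<close> unfolding psd_def by (subst fun_form) auto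
  next
    assume "A \<in> carrier_mat n n \<and> (\<forall>g. 0 \<le> (\<Sum>a<n. \<Sum>b<n. A $$ (a, b) * g b * cnj (g a)))"
    then show "psd n A" unfolding psd_def using form by auto
  qed
qed

lemma psd_quadratic_form: "psd n A \<Longrightarrow> 0 \<le> (\<Sum>a<n. \<Sum>b<n. A $$ (a, b) * g b * cnj (g a))"
  unfolding psd_iff_quadratic_form by (elim conjE allE)

lemma psd_sum_of_mats:
  assumes "finite I" "\<And>i. i \<in> I \<Longrightarrow> psd n (X i)"
  shows "psd n (sum_of_mats n X I)"
proof -
  have S: "sum_of_mats n X I \<in> carrier_mat n n"
    "\<And>a b. a < n \<Longrightarrow> b < n \<Longrightarrow> sum_of_mats n X I $$ (a, b) = (\<Sum>i\<in>I. X i $$ (a, b))"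
    using sum_of_mats_carrier_index[of I X n] assms by (auto simp: psd_def)
  have "(\<Sum>a<n. \<Sum>b<n. sum_of_mats n X I $$ (a, b) * g b * cnj (g a))
      = (\<Sum>i\<in>I. \<Sum>a<n. \<Sum>b<n. X i $$ (a, b) * g b * cnj (g a))" for g
  proof -
    have "(\<Sum>a<n. \<Sum>b<n. sum_of_mats n X I $$ (a, b) * g b * cnj (g a))
      = (\<Sum>a<n. \<Sum>b<n. \<Sum>i\<in>I. X i $$ (a, b) * g b * cnj (g a))"
      by (intro sum.cong refl) (simp add: S sum_distrib_right)
    also have "\<dots> = (\<Sum>a<n. \<Sum>i\<in>I. \<Sum>b<n. X i $$ (a, b) * g b * cnj (g a))"
      by (intro sum.cong refl sum.swap)
    also have "\<dots> = (\<Sum>i\<in>I. \<Sum>a<n. \<Sum>b<n. X i $$ (a, b) * g b * cnj (g a))"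
      by (rule sum.swap)
    finally show ?thesis .
  qed
  then show ?thesis
    using S(1) assms(2)
    by (subst psd_iff_quadratic_form) (simp add: sum_nonneg psd_quadratic_form)
qed

lemma psd_ketbra: "w \<in> carrier_vec n \<Longrightarrow> psd n (ketbra w w)"
proof -
  assume w: "w \<in> carrier_vec n"
  have "(\<Sum>a<n. \<Sum>b<n. ketbra w w $$ (a, b) * g b * cnj (g a))
      = (\<Sum>a<n. w $ a * cnj (g a)) * cnj (\<Sum>a<n. w $ a * cnj (g a))" for g
    using w unfolding cnj_sum sum_product
    by (intro sum.cong refl) (auto simp: ketbra_def mult_ac)
  moreover have "0 \<le> z * cnj z" for z
    by (simp add: complex_mult_cnj less_eq_complex_def)
  moreover have "ketbra w w \<in> carrier_mat n n"
    using w by (auto simp: ketbra_def)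
  ultimately show ?thesis
    by (simp add: psd_iff_quadratic_form del: cnj_sum)
qed

lemma sum_swap_pairs:
  fixes T :: "nat \<Rightarrow> nat \<Rightarrow> nat \<Rightarrow> nat \<Rightarrow> complex"
  shows "(\<Sum>p<m. \<Sum>q<m. \<Sum>l<n. \<Sum>j<n. T p q l j) = (\<Sum>l<n. \<Sum>j<n. \<Sum>p<m. \<Sum>q<m. T p q l j)"
proof -
  have "(\<Sum>p<m. \<Sum>q<m. \<Sum>l<n. \<Sum>j<n. T p q l j)
    = (\<Sum>x\<in>{..<m}\<times>{..<m}. \<Sum>y\<in>{..<n}\<times>{..<n}. T (fst x) (snd x) (fst y) (snd y))"
    unfolding sum.cartesian_product' by simp
  also have "\<dots> = (\<Sum>y\<in>{..<n}\<times>{..<n}. \<Sum>x\<in>{..<m}\<times>{..<m}. T (fst x) (snd x) (fst y) (snd y))"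
    by (rule sum.swap)
  also have "\<dots> = (\<Sum>l<n. \<Sum>j<n. \<Sum>p<m. \<Sum>q<m. T p q l j)"
    unfolding sum.cartesian_product' by simp
  finally show ?thesis .
qed

text \<open>
  The matrix is \<open>M A M\<^sup>*\<close> for an \<open>m \<times> n\<close> matrix \<open>M\<close>: its quadratic form at \<open>g\<close> is that of \<open>A\<close> at
  \<open>M\<^sup>* g\<close>.
\<close>

lemma psd_congruence:
  assumes "psd n A"
  shows "psd m (mat m m (\<lambda>(p, q). \<Sum>l<n. \<Sum>j<n. M p l * A $$ (l, j) * cnj (M q j)))" (is "psd m ?B")
proof -
  have "(\<Sum>p<m. \<Sum>q<m. ?B $$ (p, q) * g q * cnj (g p))
      = (\<Sum>l<n. \<Sum>j<n. A $$ (l, j) * (\<Sum>q<m. cnj (M q j) * g q) * cnj (\<Sum>p<m. cnj (M p l) * g p))" for g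
  proof -
    have "(\<Sum>p<m. \<Sum>q<m. ?B $$ (p, q) * g q * cnj (g p))
      = (\<Sum>p<m. \<Sum>q<m. \<Sum>l<n. \<Sum>j<n. A $$ (l, j) * (cnj (M q j) * g q) * (M p l * cnj (g p)))"
      by (intro sum.cong refl) (simp add: sum_distrib_right sum_distrib_left mult_ac)
    also have "\<dots> = (\<Sum>l<n. \<Sum>j<n. \<Sum>p<m. \<Sum>q<m. A $$ (l, j) * (cnj (M q j) * g q) * (M p l * cnj (g p)))"
      by (rule sum_swap_pairs)
    also have "\<dots> = (\<Sum>l<n. \<Sum>j<n. A $$ (l, j) * (\<Sum>q<m. cnj (M q j) * g q) * cnj (\<Sum>p<m. cnj (M p l) * g p))"
      by (simp add: sum_distrib_left sum_distrib_right)
    finally show ?thesis .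
  qed
  moreover note psd_quadratic_form[OF assms]
  ultimately show ?thesis
    unfolding psd_iff_quadratic_form by (simp only: mat_carrier simp_thms)
qed

text \<open>
  Expansion of the sesquilinear form at \<open>g + c e\<^sub>i\<close>.  Choosing \<open>g\<close> and \<open>c\<close> here gives Hermitian
  symmetry, the vanishing of a row whose diagonal entry is zero, and the elimination step.
\<close>

lemma quadratic_form_perturbed:
  fixes X :: "nat \<Rightarrow> nat \<Rightarrow> complex"
  assumes "i < n"
  shows "(\<Sum>a<n. \<Sum>b<n. X a b * (g b + (if b = i then c else 0)) * cnj (g a + (if a = i then c else 0)))
    = (\<Sum>a<n. \<Sum>b<n. X a b * g b * cnj (g a)) + cnj c * (\<Sum>b<n. X i b * g b)
      + c * (\<Sum>a<n. X a i * cnj (g a)) + c * cnj c * X i i"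
proof -
  let ?d = "\<lambda>a. if a = i then c else 0"
  have "(\<Sum>a<n. \<Sum>b<n. X a b * (g b + ?d b) * cnj (g a + ?d a))
    = (\<Sum>a<n. \<Sum>b<n. X a b * g b * cnj (g a)) + (\<Sum>a<n. \<Sum>b<n. X a b * g b * cnj (?d a))
     + (\<Sum>a<n. \<Sum>b<n. X a b * ?d b * cnj (g a)) + (\<Sum>a<n. \<Sum>b<n. X a b * ?d b * cnj (?d a))"
    by (simp add: algebra_simps sum.distrib del: sum.delta sum.delta')
  moreover have "(\<Sum>a<n. \<Sum>b<n. X a b * g b * cnj (?d a)) = (\<Sum>a<n. if a = i then cnj c * (\<Sum>b<n. X i b * g b) else 0)"
    by (intro sum.cong refl) (auto simp: sum_distrib_left mult_ac)
  moreover have "(\<Sum>a<n. \<Sum>b<n. X a b * ?d b * cnj (g a)) = (\<Sum>a<n. \<Sum>b<n. if b = i then c * (X a i * cnj (g a)) else 0)"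
    by (intro sum.cong refl) (auto simp: mult_ac)
  moreover have "(\<Sum>a<n. \<Sum>b<n. X a b * ?d b * cnj (?d a)) = (\<Sum>a<n. \<Sum>b<n. if b = i then (if a = i then c * cnj c * X i i else 0) else 0)"
    by (intro sum.cong refl) (auto simp: mult_ac)
  ultimately show ?thesis
    using assms by (simp add: sum_distrib_left)
qed

text \<open>
  Positivity tested on \<open>e\<^sub>j + c e\<^sub>i\<close>, that is, on the principal submatrix at \<open>i\<close> and \<open>j\<close>.
\<close>

lemma psd_two_point:
  assumes "psd n X" "i < n" "j < n"
  shows "0 \<le> X $$ (j, j) + cnj c * X $$ (i, j) + c * X $$ (j, i) + c * cnj c * X $$ (i, i)"
proof -
  have *: "(\<Sum>a<n. \<Sum>b<n. X $$ (a, b) * (if b = j then 1 else 0) * cnj (if a = j then 1 else 0)) = X $$ (j, j)"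
  proof -
    have "(\<Sum>a<n. \<Sum>b<n. X $$ (a, b) * (if b = j then 1 else 0) * cnj (if a = j then 1 else 0))
      = (\<Sum>a<n. \<Sum>b<n. if b = j then (if a = j then X $$ (a,b) else 0) else 0)"
      by (intro sum.cong refl) auto
    then show ?thesis using assms by simp
  qed
  have "0 \<le> (\<Sum>a<n. \<Sum>b<n. X $$ (a, b) * ((if b = j then 1 else 0) + (if b = i then c else 0))
      * cnj ((if a = j then 1 else 0) + (if a = i then c else 0)))"
    using assms(1) by (rule psd_quadratic_form)
  also have "\<dots> = X $$ (j, j) + cnj c * X $$ (i, j) + c * X $$ (j, i) + c * cnj c * X $$ (i, i)"
    using assms
    by (subst quadratic_form_perturbed[where X="\<lambda>a b. X $$ (a,b)" and i = i, OF assms(2)], subst *)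
      (simp add: if_distrib[of cnj] if_distrib[of "\<lambda>x. _ * x"] cong: if_cong)
  finally show ?thesis .
qed

lemma psd_diag_nonneg: "psd n X \<Longrightarrow> i < n \<Longrightarrow> 0 \<le> X $$ (i, i)"
  using psd_two_point[of n X i i 0] by simp

text \<open>
  Polarization: at \<open>c = 1\<close> the two-point form forces \<open>X\<^sub>i\<^sub>j + X\<^sub>j\<^sub>i\<close> to be real, and at \<open>c = \<i>\<close> it
  forces \<open>\<i> (X\<^sub>j\<^sub>i - X\<^sub>i\<^sub>j)\<close> to be real.
\<close>

lemma psd_hermitian:
  assumes "psd n X" "i < n" "j < n"
  shows "X $$ (j, i) = cnj (X $$ (i, j))"
proof (rule complex_eqI)
  note diag = psd_diag_nonneg[OF assms(1,2)] psd_diag_nonneg[OF assms(1,3)]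
  show "Im (X $$ (j, i)) = Im (cnj (X $$ (i, j)))"
    using psd_two_point[OF assms, of 1] diag by (simp add: less_eq_complex_def)
  show "Re (X $$ (j, i)) = Re (cnj (X $$ (i, j)))"
    using psd_two_point[OF assms, of \<i>] diag by (simp add: less_eq_complex_def)
qed

text \<open>
  If \<open>X\<^sub>i\<^sub>i = 0\<close>, the two-point form is affine in \<open>c\<close> over the reals, so a nonzero \<open>X\<^sub>i\<^sub>j\<close> would
  make it negative for a large \<open>c\<close> of suitable phase.
\<close>

lemma psd_zero_diag:
  assumes "psd n X" "i < n" "j < n" "X $$ (i, i) = 0"
  shows "X $$ (i, j) = 0"
proof (rule ccontr)
  assume nz: "X $$ (i, j) \<noteq> 0"
  define N where "N = (cmod (X $$ (i, j)))\<^sup>2"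
  (* With c = - s X_ij the form equals X_jj - 2 s N; this s makes it -1. *)
  define s where "s = (Re (X $$ (j, j)) + 1) / (2 * N)"
  have N: "N > 0" "X $$ (i, j) * cnj (X $$ (i, j)) = of_real N"
    using nz by (simp_all add: N_def flip: complex_norm_square)
  have "0 \<le> X $$ (j, j) - 2 * of_real s * of_real N"
    using psd_two_point[OF assms(1-3), of "- of_real s * X $$ (i, j)"] assms(4)
      psd_hermitian[OF assms(1-3)] unfolding N(2)[symmetric] by (simp add: mult_ac)
  then have "0 \<le> Re (X $$ (j, j)) - 2 * s * N"
    by (simp add: less_eq_complex_def)
  then show False using N by (simp add: s_def)
qed

text \<open>
  One step of Cholesky elimination: the quadratic form of the remainder at \<open>g\<close> is that of \<open>X\<close> at
  \<open>g - (z / X\<^sub>i\<^sub>i) e\<^sub>i\<close> with \<open>z = (X g)\<^sub>i\<close>, the minimum of the form of \<open>X\<close> on the line \<open>g + \<complex> e\<^sub>i\<close>.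
\<close>

lemma psd_peel:
  assumes X: "psd n X" and i: "i < n" and nz: "X $$ (i, i) \<noteq> 0"
  shows "psd n (mat n n (\<lambda>(a, b). X $$ (a, b) - X $$ (a, i) * cnj (X $$ (b, i)) / X $$ (i, i)))" (is "psd n ?Y")
proof -
  let ?d = "X $$ (i, i)"
  have dreal: "cnj ?d = ?d"
    using psd_hermitian[OF X i i] by simp
  have "0 \<le> (\<Sum>a<n. \<Sum>b<n. ?Y $$ (a, b) * g b * cnj (g a))" for g
  proof -
    define z where "z = (\<Sum>b<n. X $$ (i, b) * g b)"
    have zc: "(\<Sum>a<n. X $$ (a, i) * cnj (g a)) = cnj z"
      unfolding z_def cnj_sum using psd_hermitian[OF X i] by (auto intro!: sum.cong)
    have z': "(\<Sum>b<n. cnj (X $$ (b, i)) * g b) = z"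
      unfolding z_def using psd_hermitian[OF X _ i] by (auto intro!: sum.cong)
    have "(\<Sum>a<n. \<Sum>b<n. ?Y $$ (a, b) * g b * cnj (g a))
      = (\<Sum>a<n. \<Sum>b<n. X $$ (a, b) * g b * cnj (g a) - (X $$ (a, i) * cnj (g a)) * (cnj (X $$ (b, i)) * g b) / ?d)"
      by (intro sum.cong refl) (auto simp: algebra_simps)
    also have "\<dots> = (\<Sum>a<n. \<Sum>b<n. X $$ (a, b) * g b * cnj (g a)) - cnj z * z / ?d"
      by (simp add: sum_subtractf flip: sum_divide_distrib sum_product z' zc)
    also have "\<dots> = (\<Sum>a<n. \<Sum>b<n. X $$ (a, b) * (g b + (if b = i then - z / ?d else 0))
         * cnj (g a + (if a = i then - z / ?d else 0)))"
      by (subst quadratic_form_perturbed[where X="\<lambda>a b. X $$ (a,b)", OF i])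
        (use nz in \<open>simp add: dreal zc flip: z_def\<close>)
    also have "0 \<le> \<dots>"
      using X by (rule psd_quadratic_form)
    finally show ?thesis .
  qed
  then show ?thesis by (auto simp: psd_iff_quadratic_form)
qed

text \<open>
  Peeling off the rank-one part through a nonzero diagonal entry clears that entry and creates no
  new nonzero diagonal entry, so the process ends; what is left has zero diagonal and therefore
  vanishes.
\<close>

lemma psd_sum_of_ketbras:
  assumes "psd n X"
  obtains r :: nat and w where "\<And>i. i < r \<Longrightarrow> w i \<in> carrier_vec n"
    "X = sum_of_mats n (\<lambda>i. ketbra (w i) (w i)) {..<r}"
proof -
  have "\<exists>(r::nat) w. (\<forall>i<r. w i \<in> carrier_vec n) \<and>
      (\<forall>a<n. \<forall>b<n. X $$ (a, b) = (\<Sum>i<r. w i $ a * cnj (w i $ b)))"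
    using assms
  proof (induction "card {i. i < n \<and> X $$ (i, i) \<noteq> 0}" arbitrary: X rule: less_induct)
    case (less X)
    show ?case
    proof (cases "\<exists>i<n. X $$ (i, i) \<noteq> 0")
      case False
      then have "\<forall>a<n. \<forall>b<n. X $$ (a, b) = 0"
        using psd_zero_diag[OF less.prems] by blast
      then show ?thesis by (intro exI[of _ "0::nat"] exI[of _ "\<lambda>_::nat. 0\<^sub>v n :: complex vec"]) simp
    next
      case True
      then obtain i where i: "i < n" "X $$ (i, i) \<noteq> 0" by auto
      let ?d = "X $$ (i, i)"
      define Y where "Y = mat n n (\<lambda>(a, b). X $$ (a, b) - X $$ (a, i) * cnj (X $$ (b, i)) / ?d)"
      have Y: "psd n Y" unfolding Y_def by (rule psd_peel[OF less.prems i])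
      have d: "cnj ?d = ?d" "?d = of_real (Re ?d)" "Re ?d > 0"
        using psd_hermitian[OF less.prems i(1) i(1)] psd_diag_nonneg[OF less.prems i(1)] i(2)
        by (auto simp: less_eq_complex_def complex_eq_iff)
      have "{j. j < n \<and> Y $$ (j, j) \<noteq> 0} \<subset> {j. j < n \<and> X $$ (j, j) \<noteq> 0}"
      proof
        have "X $$ (j, i) = 0" if "j < n" "X $$ (j, j) = 0" for j
          using psd_zero_diag[OF less.prems that(1) i(1) that(2)] .
        then show "{j. j < n \<and> Y $$ (j, j) \<noteq> 0} \<subseteq> {j. j < n \<and> X $$ (j, j) \<noteq> 0}"
          by (auto simp: Y_def)
        have "Y $$ (i, i) = 0" using i d(1) by (simp add: Y_def)
        then show "{j. j < n \<and> Y $$ (j, j) \<noteq> 0} \<noteq> {j. j < n \<and> X $$ (j, j) \<noteq> 0}"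
          using i by blast
      qed
      then have "card {j. j < n \<and> Y $$ (j, j) \<noteq> 0} < card {j. j < n \<and> X $$ (j, j) \<noteq> 0}"
        by (intro psubset_card_mono) auto
      from less.hyps[OF this Y] obtain r :: nat and w where w: "\<forall>i<r. w i \<in> carrier_vec n"
        "\<forall>a<n. \<forall>b<n. Y $$ (a, b) = (\<Sum>i<r. w i $ a * cnj (w i $ b))" by blast
      define u where "u = vec n (\<lambda>a. X $$ (a, i) / of_real (sqrt (Re ?d)))"
      have ss: "complex_of_real (sqrt (Re ?d)) * of_real (sqrt (Re ?d)) = ?d"
        using d by (simp flip: of_real_mult)
      have "X $$ (a, b) = (\<Sum>j<Suc r. (w(r := u)) j $ a * cnj ((w(r := u)) j $ b))"
        if "a < n" "b < n" for a b
      proof -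
        have "(\<Sum>j<Suc r. (w(r := u)) j $ a * cnj ((w(r := u)) j $ b))
            = Y $$ (a, b) + u $ a * cnj (u $ b)"
          using w that by simp
        also have "u $ a * cnj (u $ b) = X $$ (a, i) * cnj (X $$ (b, i)) / ?d"
          using that by (simp add: u_def ss)
        finally show ?thesis using that by (simp add: Y_def)
      qed
      moreover have "\<forall>j<Suc r. (w(r := u)) j \<in> carrier_vec n"
        using w(1) by (auto simp: u_def less_Suc_eq)
      ultimately show ?thesis by blast
    qed
  qed
  then obtain r :: nat and w where w: "\<forall>i<r. w i \<in> carrier_vec n"
      "\<forall>a<n. \<forall>b<n. X $$ (a, b) = (\<Sum>i<r. w i $ a * cnj (w i $ b))" by blast
  have "X = sum_of_mats n (\<lambda>i. ketbra (w i) (w i)) {..<r}"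
    using w assms
    by (intro eq_sum_of_matsI) (auto simp: psd_def ketbra_index ketbra_carrier intro!: sum.cong)
  then show ?thesis using that w(1) by blast
qed

section \<open>Block matrices and ampliations of linear maps\<close>

lemma block_index:
  fixes p k d x :: nat
  assumes "p < k" "x < d"
  shows "p * d + x < k * d" "(p * d + x) div d = p" "(p * d + x) mod d = x"
proof -
  have "p * d + x < (p + 1) * d" using assms by simp
  also have "\<dots> \<le> k * d" using assms by (intro mult_right_mono) auto
  finally show "p * d + x < k * d" .
qed (use assms in auto)

lemma block_index_split:
  fixes i k d :: nat
  assumes "i < k * d"
  shows "i div d < k" "i mod d < d"
  using assms by (cases d; auto simp: less_mult_imp_div_less)+

lemma kronecker_index:
  assumes "A \<in> carrier_mat m m" "B \<in> carrier_mat n n" "i < m * n" "j < m * n"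
  shows "kronecker A B $$ (i, j) = A $$ (i div n, j div n) * B $$ (i mod n, j mod n)"
  using assms by (auto simp: kronecker_def)

lemma mat_block_carrier: "mat_block d X p q \<in> carrier_mat d d"
  by (simp add: mat_block_def)

text \<open>
  The entrywise form of a block matrix; both ampliations and principal blocks of Choi matrices are
  of this shape, and all later computations with them go through entries.
\<close>

lemma sum_of_unit_blocks:
  assumes G: "\<And>p q. p < k \<Longrightarrow> q < k \<Longrightarrow> G p q \<in> carrier_mat d d"
  shows "sum_of_mats (k * d) (\<lambda>(p, q). kronecker (std_unit k p q) (G p q)) ({..<k} \<times> {..<k})
    = mat (k * d) (k * d) (\<lambda>(i, j). G (i div d) (j div d) $$ (i mod d, j mod d))"
proof (rule eq_sum_of_matsI[symmetric])
  fix i j assume ij: "i < k * d" "j < k * d"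
  note s = block_index_split[OF ij(1)] block_index_split[OF ij(2)]
  have "(\<Sum>x\<in>{..<k} \<times> {..<k}. (case x of (p, q) \<Rightarrow> kronecker (std_unit k p q) (G p q)) $$ (i, j))
    = (\<Sum>x\<in>{..<k} \<times> {..<k}. if x = (i div d, j div d) then G (i div d) (j div d) $$ (i mod d, j mod d) else 0)"
  proof (rule sum.cong[OF refl])
    fix x assume "x \<in> {..<k} \<times> {..<k}"
    then obtain p q where x: "x = (p, q)" "p < k" "q < k" by auto
    have "kronecker (std_unit k p q) (G p q) $$ (i, j)
      = std_unit k p q $$ (i div d, j div d) * G p q $$ (i mod d, j mod d)"
      by (rule kronecker_index[OF _ G ij]) (auto simp: x std_unit_def)
    then show "(case x of (p, q) \<Rightarrow> kronecker (std_unit k p q) (G p q)) $$ (i, j)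
      = (if x = (i div d, j div d) then G (i div d) (j div d) $$ (i mod d, j mod d) else 0)"
      using s x by (auto simp: std_unit_def)
  qed
  then show "mat (k * d) (k * d) (\<lambda>(i, j). G (i div d) (j div d) $$ (i mod d, j mod d)) $$ (i, j)
    = (\<Sum>x\<in>{..<k} \<times> {..<k}. (case x of (p, q) \<Rightarrow> kronecker (std_unit k p q) (G p q)) $$ (i, j))"
    using ij s by simp
qed (auto intro!: kronecker_carrier G simp: std_unit_def)

lemma linear_on_mats_carrier:
  assumes "linear_on_mats d1 d2 \<Phi>" "Y \<in> carrier_mat d1 d1"
  shows "\<Phi> Y \<in> carrier_mat d2 d2"
proof -
  interpret linear_map class_ring "module_mat TYPE(complex) d1 d1" "module_mat TYPE(complex) d2 d2" \<Phi>
    by (rule assms)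
  show ?thesis
    using f_hom assms(2) by (auto simp: LinearCombinations.module_hom_def module_mat_simps)
qed

lemma linear_on_mats_smult:
  assumes "linear_on_mats d1 d2 \<Phi>" "Y \<in> carrier_mat d1 d1"
  shows "\<Phi> (c \<cdot>\<^sub>m Y) = c \<cdot>\<^sub>m \<Phi> Y"
proof -
  interpret linear_map class_ring "module_mat TYPE(complex) d1 d1" "module_mat TYPE(complex) d2 d2" \<Phi>
    by (rule assms)
  show ?thesis
    using f_smult[of c Y] assms(2) by (simp add: module_mat_simps class_ring_simps)
qed

lemma sum_of_mats_empty: "sum_of_mats n f {} = 0\<^sub>m n n"
proof -
  interpret abelian_group "module_mat TYPE(complex) n n" by (rule abelian_group_mat)
  show ?thesis by (simp add: module_mat_simps)
qed

lemma sum_of_mats_insert: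
  assumes "finite I" "x \<notin> I" "\<And>y. y \<in> insert x I \<Longrightarrow> f y \<in> carrier_mat n n"
  shows "sum_of_mats n f (insert x I) = f x + sum_of_mats n f I"
proof -
  interpret abelian_group "module_mat TYPE(complex) n n" by (rule abelian_group_mat)
  show ?thesis using assms by (subst finsum_insert) (auto simp: module_mat_simps)
qed

lemma linear_on_mats_sum:
  assumes lin: "linear_on_mats d1 d2 \<Phi>" and "finite I" "\<And>x. x \<in> I \<Longrightarrow> Y x \<in> carrier_mat d1 d1"
  shows "\<Phi> (sum_of_mats d1 Y I) = sum_of_mats d2 (\<lambda>x. \<Phi> (Y x)) I"
proof -
  interpret linear_map class_ring "module_mat TYPE(complex) d1 d1" "module_mat TYPE(complex) d2 d2" \<Phi>
    by (rule lin)
  show ?thesis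
    using assms(2,3)
  proof (induction I rule: finite_induct)
    case empty
    have "\<Phi> (0\<^sub>m d1 d1) = \<Phi> (0 \<cdot>\<^sub>m 0\<^sub>m d1 d1)" by simp
    also have "\<dots> = 0 \<cdot>\<^sub>m \<Phi> (0\<^sub>m d1 d1)"
      by (rule linear_on_mats_smult[OF lin]) simp
    also have "\<dots> = 0\<^sub>m d2 d2"
      using linear_on_mats_carrier[OF lin, of "0\<^sub>m d1 d1"] by (intro eq_matI) auto
    finally show ?case by (simp add: sum_of_mats_empty)
  next
    case (insert x I)
    have "\<Phi> (sum_of_mats d1 Y (insert x I)) = \<Phi> (Y x + sum_of_mats d1 Y I)"
      using insert by (subst sum_of_mats_insert) auto
    also have "\<dots> = \<Phi> (Y x) + \<Phi> (sum_of_mats d1 Y I)"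
      using f_add[of "Y x" "sum_of_mats d1 Y I"] insert sum_of_mats_carrier[of I Y d1]
      by (simp add: module_mat_simps)
    also have "\<dots> = sum_of_mats d2 (\<lambda>x. \<Phi> (Y x)) (insert x I)"
      using insert linear_on_mats_carrier[OF lin]
      by (subst sum_of_mats_insert) auto
    finally show ?case .
  qed
qed

lemma ampliation_eq_mat:
  assumes "linear_on_mats d1 d2 \<Phi>"
  shows "ampliation k d1 d2 \<Phi> X = mat (k * d2) (k * d2)
    (\<lambda>(i, j). \<Phi> (mat_block d1 X (i div d2) (j div d2)) $$ (i mod d2, j mod d2))"
  unfolding ampliation_def
  by (rule sum_of_unit_blocks) (rule linear_on_mats_carrier[OF assms mat_block_carrier])

lemma choi_principal_block_eq_mat:
  assumes "\<And>p q. p < k \<Longrightarrow> q < k \<Longrightarrow> \<Phi> (F (s p) (s q)) \<in> carrier_mat d2 d2"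
  shows "choi_principal_block k d2 F \<Phi> s = mat (k * d2) (k * d2)
    (\<lambda>(i, j). \<Phi> (F (s (i div d2)) (s (j div d2))) $$ (i mod d2, j mod d2))"
  unfolding choi_principal_block_def by (rule sum_of_unit_blocks) (rule assms)

lemma mat_block_sum:
  assumes "finite I" "\<And>x. x \<in> I \<Longrightarrow> X x \<in> carrier_mat (k * d) (k * d)" "p < k" "q < k"
  shows "mat_block d (sum_of_mats (k * d) X I) p q = sum_of_mats d (\<lambda>x. mat_block d (X x) p q) I"
  using assms by (intro eq_sum_of_matsI mat_block_carrier)
    (auto simp: mat_block_def block_index sum_of_mats_index)

lemma ampliation_sum:
  assumes lin: "linear_on_mats d1 d2 \<Phi>"
    and I: "finite I" "\<And>x. x \<in> I \<Longrightarrow> X x \<in> carrier_mat (k * d1) (k * d1)"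
  shows "ampliation k d1 d2 \<Phi> (sum_of_mats (k * d1) X I)
    = sum_of_mats (k * d2) (\<lambda>x. ampliation k d1 d2 \<Phi> (X x)) I"
proof (rule eq_sum_of_matsI)
  fix i j assume ij: "i < k * d2" "j < k * d2"
  note s = block_index_split[OF ij(1)] block_index_split[OF ij(2)]
  have "\<Phi> (mat_block d1 (sum_of_mats (k * d1) X I) (i div d2) (j div d2))
    = sum_of_mats d2 (\<lambda>x. \<Phi> (mat_block d1 (X x) (i div d2) (j div d2))) I"
    by (simp add: mat_block_sum[OF I s(1,3)] linear_on_mats_sum[OF lin I(1)] mat_block_carrier)
  then show "ampliation k d1 d2 \<Phi> (sum_of_mats (k * d1) X I) $$ (i, j)
    = (\<Sum>x\<in>I. ampliation k d1 d2 \<Phi> (X x) $$ (i, j))"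
    using ij s by (simp add: ampliation_eq_mat[OF lin] sum_of_mats_index[OF I(1)]
        linear_on_mats_carrier[OF lin mat_block_carrier])
qed (use I in \<open>auto simp: ampliation_eq_mat[OF lin]\<close>)

lemma mat_block_ketbra:
  assumes "w \<in> carrier_vec (k * d)" "p < k" "q < k"
  shows "mat_block d (ketbra w w) p q
    = ketbra (vec d (\<lambda>x. w $ (p * d + x))) (vec d (\<lambda>x. w $ (q * d + x)))"
  using assms by (intro eq_matI) (auto simp: mat_block_def ketbra_def block_index)

section \<open>Separable matrices\<close>

lemma separable_finite_sumI:
  assumes "finite I" "\<And>i. i \<in> I \<Longrightarrow> psd m (A i)" "\<And>i. i \<in> I \<Longrightarrow> psd n (B i)"
    and "psd (m * n) X" "X = sum_of_mats (m * n) (\<lambda>i. kronecker (A i) (B i)) I"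
  shows "separable m n X"
proof -
  obtain h where h: "bij_betw h {..<card I} I"
    using ex_bij_betw_nat_finite[OF assms(1)] by (auto simp: atLeast0LessThan)
  then have hI: "h t \<in> I" if "t < card I" for t
    using that by (auto dest: bij_betwE)
  have AB: "kronecker (A i) (B i) \<in> carrier_mat (m * n) (m * n)" if "i \<in> I" for i
    using assms(2,3)[OF that] by (auto simp: psd_def)
  have "X = sum_of_mats (m * n) (\<lambda>t. kronecker (A (h t)) (B (h t))) {..<card I}"
  proof (rule eq_sum_of_matsI)
    fix a b assume ab: "a < m * n" "b < m * n"
    show "X $$ (a, b) = (\<Sum>t<card I. kronecker (A (h t)) (B (h t)) $$ (a, b))"
      using sum.reindex_bij_betw[OF h, of "\<lambda>i. kronecker (A i) (B i) $$ (a, b)"]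
      unfolding assms(5) by (simp add: sum_of_mats_index[OF assms(1) AB ab])
  qed (use AB hI assms(4) in \<open>auto simp: psd_def\<close>)
  then show ?thesis
    unfolding separable_def using assms(2-4) hI
    by (intro conjI exI[of _ "card I"] exI[of _ "A \<circ> h"] exI[of _ "B \<circ> h"]) auto
qed

lemma separable_sum:
  assumes I: "finite I" and sep: "\<And>i. i \<in> I \<Longrightarrow> separable m n (X i)"
  shows "separable m n (sum_of_mats (m * n) X I)"
proof -
  have "\<forall>i. \<exists>r A B. i \<in> I \<longrightarrow> (\<forall>t<r. psd m (A t) \<and> psd n (B t)) \<and>
      X i = sum_of_mats (m * n) (\<lambda>t. kronecker (A t) (B t)) {..<r::nat}"
    using sep unfolding separable_def by blast
  then obtain r A B where rAB: "\<And>i. i \<in> I \<Longrightarrow> (\<forall>t<r i. psd m (A i t) \<and> psd n (B i t)) \<and>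
      X i = sum_of_mats (m * n) (\<lambda>t. kronecker (A i t) (B i t)) {..<r i :: nat}"
    by metis
  have psdX: "psd (m * n) (X i)" if "i \<in> I" for i
    using sep[OF that] by (simp add: separable_def)
  have K: "kronecker (A i t) (B i t) \<in> carrier_mat (m * n) (m * n)" if "i \<in> I" "t < r i" for i t
    using rAB that by (auto simp: psd_def)
  have S: "psd (m * n) (sum_of_mats (m * n) X I)"
    by (rule psd_sum_of_mats[OF I psdX])
  have "sum_of_mats (m * n) X I
    = sum_of_mats (m * n) (\<lambda>x. kronecker (A (fst x) (snd x)) (B (fst x) (snd x))) (Sigma I (\<lambda>i. {..<r i}))"
  proof (rule eq_sum_of_matsI)
    fix a b assume ab: "a < m * n" "b < m * n"
    have "sum_of_mats (m * n) X I $$ (a, b) = (\<Sum>i\<in>I. X i $$ (a, b))"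
      using psdX by (intro sum_of_mats_index I ab) (auto simp: psd_def)
    also have "\<dots> = (\<Sum>i\<in>I. \<Sum>t<r i. kronecker (A i t) (B i t) $$ (a, b))"
    proof (rule sum.cong[OF refl])
      fix i assume i: "i \<in> I"
      have "X i $$ (a, b) = sum_of_mats (m * n) (\<lambda>t. kronecker (A i t) (B i t)) {..<r i} $$ (a, b)"
        using rAB[OF i] by simp
      then show "X i $$ (a, b) = (\<Sum>t<r i. kronecker (A i t) (B i t) $$ (a, b))"
        using sum_of_mats_index[of "{..<r i}" "\<lambda>t. kronecker (A i t) (B i t)" "m * n" a b] K[OF i] ab by simp
    qed
    also have "\<dots> = (\<Sum>x\<in>Sigma I (\<lambda>i. {..<r i}). kronecker (A (fst x) (snd x)) (B (fst x) (snd x)) $$ (a, b))"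
      by (subst sum.Sigma) (auto simp: I split_def)
    finally show "sum_of_mats (m * n) X I $$ (a, b)
      = (\<Sum>x\<in>Sigma I (\<lambda>i. {..<r i}). kronecker (A (fst x) (snd x)) (B (fst x) (snd x)) $$ (a, b))" .
  qed (use I K S in \<open>auto simp: psd_def\<close>)
  then show ?thesis
    using I rAB by (intro separable_finite_sumI[OF _ _ _ S]) auto
qed

section \<open>Orthonormal bases adapted to a family of vectors\<close>

lemma orthonormal_basis_carrier:
  assumes "orthonormal_basis d f" "i < d"
  shows "f i \<in> carrier_vec d"
proof -
  interpret vec_space "TYPE(complex)" d .
  show ?thesis using assms by (auto simp: orthonormal_basis_def basis_def)
qed

text \<open>
  The conjugates of fewer than \<open>d\<close> vectors, completed by zero rows, form a singular \<open>d \<times> d\<close>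
  matrix; a nonzero vector in its kernel is orthogonal to all of them.
\<close>

lemma orthogonal_nonzero_vec:
  fixes f :: "nat \<Rightarrow> complex vec"
  assumes "n < d" "\<And>i. i < n \<Longrightarrow> f i \<in> carrier_vec d"
  obtains g where "g \<in> carrier_vec d" "g \<noteq> 0\<^sub>v d" "\<And>i. i < n \<Longrightarrow> g \<bullet>c f i = 0"
proof -
  define A where "A = mat\<^sub>r d d (\<lambda>i. if i = n then 0\<^sub>v d else if i < n then conjugate (f i) else 0\<^sub>v d)"
  have A: "A \<in> carrier_mat d d" by (simp add: A_def)
  have "det A = 0"
    unfolding A_def using assms by (intro det_row_0) auto
  then obtain g where g: "g \<in> carrier_vec d" "g \<noteq> 0\<^sub>v d" "A *\<^sub>v g = 0\<^sub>v d"
    using det_0_iff_vec_prod_zero[OF A] by auto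
  have "g \<bullet>c f i = 0" if "i < n" for i
  proof -
    have "(A *\<^sub>v g) $ i = 0" using g that assms(1) by simp
    moreover have "(A *\<^sub>v g) $ i = conjugate (f i) \<bullet> g"
      using that assms(1) assms(2)[OF that] g(1) by (simp add: A_def)
    moreover have "conjugate (f i) \<bullet> g = g \<bullet>c f i"
      using assms(2)[OF that] g(1) by (intro comm_scalar_prod[of _ d]) auto
    ultimately show ?thesis by simp
  qed
  with g that show ?thesis by blast
qed

lemma cscalar_prod_sum:
  assumes "x \<in> carrier_vec d" "y \<in> carrier_vec d"
  shows "x \<bullet>c y = (\<Sum>i<d. x $ i * cnj (y $ i))"
  using assms by (auto simp: scalar_prod_def atLeast0LessThan intro!: sum.cong)

text \<open>
  Gram-Schmidt without an independence assumption.  Triangularity of the coefficients (\<open>l \<le> p\<close>)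
  lets a single run up to \<open>n = d\<close> both complete the basis and keep the first \<open>k\<close> vectors in the
  span of the first \<open>k\<close> basis vectors.
\<close>

lemma gram_schmidt_triangular:
  fixes v :: "nat \<Rightarrow> complex vec"
  assumes "n \<le> d"
  shows "\<exists>f c. (\<forall>i<n. f i \<in> carrier_vec d) \<and>
    (\<forall>i<n. \<forall>j<n. f i \<bullet>c f j = (if i = j then 1 else 0)) \<and>
    (\<forall>p<n. \<forall>x<d. v p $ x = (\<Sum>l\<le>p. c p l * f l $ x))"
  using assms
proof (induction n)
  case 0
  show ?case by simp
next
  case (Suc n)
  then obtain f :: "nat \<Rightarrow> complex vec" and c where
    f: "\<forall>i<n. f i \<in> carrier_vec d" "\<forall>i<n. \<forall>j<n. f i \<bullet>c f j = (if i = j then 1 else 0)"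
    and c: "\<forall>p<n. \<forall>x<d. v p $ x = (\<Sum>l\<le>p. c p l * f l $ x)" by auto
  define b where "b l = (\<Sum>x<d. v n $ x * cnj (f l $ x))" for l
  define u where "u = vec d (\<lambda>x. v n $ x - (\<Sum>l<n. b l * f l $ x))"
  have u: "u \<in> carrier_vec d" by (simp add: u_def)
  have uf: "u \<bullet>c f i = 0" if i: "i < n" for i
  proof -
    have fi: "f i \<in> carrier_vec d" using f i by auto
    have "u \<bullet>c f i = (\<Sum>x<d. (v n $ x - (\<Sum>l<n. b l * f l $ x)) * cnj (f i $ x))"
      by (simp add: cscalar_prod_sum[OF u fi]) (simp add: u_def)
    also have "\<dots> = b i - (\<Sum>x<d. \<Sum>l<n. b l * (f l $ x * cnj (f i $ x)))"
      by (simp add: b_def algebra_simps sum_subtractf sum_distrib_left)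
    also have "(\<Sum>x<d. \<Sum>l<n. b l * (f l $ x * cnj (f i $ x))) = (\<Sum>l<n. b l * (\<Sum>x<d. f l $ x * cnj (f i $ x)))"
      by (subst sum.swap) (simp add: sum_distrib_left)
    also have "\<dots> = (\<Sum>l<n. b l * (f l \<bullet>c f i))"
      using f by (intro sum.cong refl) (simp add: cscalar_prod_sum[OF _ fi])
    also have "\<dots> = (\<Sum>l<n. if l = i then b l else 0)"
      using f i by (intro sum.cong refl) auto
    finally show ?thesis using i by simp
  qed
  (* If v n already lies in the span of the previous vectors, any nonzero orthogonal direction serves. *)
  obtain h e where h: "h \<in> carrier_vec d" "h \<noteq> 0\<^sub>v d" "\<And>i. i < n \<Longrightarrow> h \<bullet>c f i = 0"
    and e: "u = e \<cdot>\<^sub>v h"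
  proof (cases "u = 0\<^sub>v d")
    case True
    obtain g where "g \<in> carrier_vec d" "g \<noteq> 0\<^sub>v d" "\<And>i. i < n \<Longrightarrow> g \<bullet>c f i = 0"
      by (rule orthogonal_nonzero_vec[of n d f]) (use f Suc.prems in auto)
    moreover from this have "u = 0 \<cdot>\<^sub>v g" using True by (intro eq_vecI) auto
    ultimately show ?thesis by (rule that)
  next
    case False
    show ?thesis by (rule that[OF u False uf]) auto
  qed
  define N where "N = Re (h \<bullet>c h)"
  have N: "h \<bullet>c h = of_real N" "N > 0"
  proof -
    have "0 < h \<bullet>c h"
      using conjugate_square_greater_0_vec[OF h(1)] h(2) by blast
    then show "h \<bullet>c h = of_real N" "N > 0"
      unfolding N_def less_complex_def complex_eq_iff by simp_all
  qed
  define s where "s = complex_of_real (sqrt N)"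
  have s: "s \<noteq> 0" "cnj s = s" "s * s = of_real N"
    using N by (auto simp: s_def simp flip: of_real_mult)
  define g where "g = (1 / s) \<cdot>\<^sub>v h"
  have g: "g \<in> carrier_vec d" using h by (simp add: g_def)
  have gf: "g \<bullet>c f i = 0" if "i < n" for i
    using h(1) h(3)[OF that] f that by (auto simp: g_def)
  have fg: "f i \<bullet>c g = 0" if i: "i < n" for i
  proof -
    have fi: "f i \<in> carrier_vec d" using f i by auto
    have "f i \<bullet>c g = cnj (g \<bullet>c f i)"
      unfolding cscalar_prod_sum[OF fi g] cscalar_prod_sum[OF g fi] by (simp add: mult.commute)
    then show ?thesis by (simp add: gf[OF i])
  qed
  have gg: "g \<bullet>c g = 1"
  proof -
    have "g \<bullet>c g = (\<Sum>x<d. (h $ x * cnj (h $ x)) / (s * s))"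
      using h(1) by (simp add: cscalar_prod_sum[OF g g]) (simp add: g_def s)
    also have "\<dots> = 1"
      using N s cscalar_prod_sum[OF h(1) h(1)] by (simp flip: sum_divide_distrib)
    finally show ?thesis .
  qed
  have vn: "v n $ x = (\<Sum>l<n. b l * f l $ x) + e * s * g $ x" if "x < d" for x
  proof -
    have "u $ x = e * s * g $ x" using that h(1) s(1) by (simp add: e g_def)
    then show ?thesis using that by (simp add: u_def algebra_simps)
  qed
  show ?case
  proof (intro exI[of _ "f(n := g)"] exI[of _ "c(n := b(n := e * s))"] conjI allI impI)
    fix i assume "i < Suc n"
    then show "(f(n := g)) i \<in> carrier_vec d" using f g by (auto simp: less_Suc_eq)
  next
    fix i j assume "i < Suc n" "j < Suc n"
    then show "(f(n := g)) i \<bullet>c (f(n := g)) j = (if i = j then 1 else 0)"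
      using f gf fg gg by (auto simp: less_Suc_eq)
  next
    fix p x assume p: "p < Suc n" and x: "x < d"
    show "v p $ x = (\<Sum>l\<le>p. (c(n := b(n := e * s))) p l * (f(n := g)) l $ x)"
    proof (cases "p = n")
      case True
      have "(\<Sum>l\<le>n. (b(n := e * s)) l * (f(n := g)) l $ x) = (\<Sum>l<n. b l * f l $ x) + e * s * g $ x"
        by (simp flip: lessThan_Suc_atMost)
      then show ?thesis using vn[OF x] True by simp
    next
      case False
      then have "p < n" using p by simp
      then show ?thesis using c x by (auto intro!: sum.cong)
    qed
  qed
qed

lemma adapted_orthonormal_basis:
  fixes v :: "nat \<Rightarrow> complex vec"
  assumes "k \<le> d"
  obtains f a where "orthonormal_basis d f"
    "\<And>p x. p < k \<Longrightarrow> x < d \<Longrightarrow> v p $ x = (\<Sum>l<k. a p l * f l $ x)"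
proof -
  obtain f c where f: "\<forall>i<d. f i \<in> carrier_vec d"
    "\<forall>i<d. \<forall>j<d. f i \<bullet>c f j = (if i = j then 1 else 0)"
    "\<forall>p<d. \<forall>x<d. v p $ x = (\<Sum>l\<le>p. c p l * f l $ x)"
    using gram_schmidt_triangular[of d d v] by blast
  have "v p $ x = (\<Sum>l<k. (if l \<le> p then c p l else 0) * f l $ x)" if "p < k" "x < d" for p x
  proof -
    have "(\<Sum>l\<le>p. c p l * f l $ x) = (\<Sum>l<k. (if l \<le> p then c p l else 0) * f l $ x)"
      using that by (intro sum.mono_neutral_cong_left) auto
    then show ?thesis using f(3) that assms by auto
  qed
  moreover have "orthonormal_basis d f"
    by (rule orthonormal_basisI) (use f(1,2) in auto)
  ultimately show ?thesis by (rule that[rotated])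
qed

section \<open>Principal blocks of Choi matrices\<close>

lemma map_ketbra_expansion:
  fixes k :: nat
  assumes lin: "linear_on_mats d1 d2 \<Phi>"
    and f: "\<And>l. l < k \<Longrightarrow> f l \<in> carrier_vec d1"
    and x: "x \<in> carrier_vec d1" "\<And>i. i < d1 \<Longrightarrow> x $ i = (\<Sum>l<k. a l * f l $ i)"
    and y: "y \<in> carrier_vec d1" "\<And>i. i < d1 \<Longrightarrow> y $ i = (\<Sum>l<k. b l * f l $ i)"
    and ij: "i < d2" "j < d2"
  shows "\<Phi> (ketbra x y) $$ (i, j) = (\<Sum>l<k. \<Sum>m<k. a l * \<Phi> (ketbra (f l) (f m)) $$ (i, j) * cnj (b m))"
proof -
  let ?I = "{..<k} \<times> {..<k}"
  let ?Y = "\<lambda>z. (a (fst z) * cnj (b (snd z))) \<cdot>\<^sub>m ketbra (f (fst z)) (f (snd z))"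
  have K: "ketbra (f (fst z)) (f (snd z)) \<in> carrier_mat d1 d1" if "z \<in> ?I" for z
    using that f by (auto intro!: ketbra_carrier)
  have "ketbra x y = sum_of_mats d1 ?Y ?I"
  proof (rule eq_sum_of_matsI)
    fix r s assume rs: "r < d1" "s < d1"
    have "ketbra x y $$ (r, s) = (\<Sum>l<k. a l * f l $ r) * cnj (\<Sum>m<k. b m * f m $ s)"
      using x y rs by (simp add: ketbra_index)
    also have "\<dots> = (\<Sum>l<k. \<Sum>m<k. ?Y (l, m) $$ (r, s))"
      unfolding cnj_sum sum_product using K rs f
      by (intro sum.cong refl) (auto simp: ketbra_index[OF f f] carrier_matD[OF ketbra_carrier[OF f f]])
    also have "\<dots> = (\<Sum>z\<in>?I. ?Y z $$ (r, s))"
      by (simp only: sum.cartesian_product split_def prod.collapse)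
    finally show "ketbra x y $$ (r, s) = (\<Sum>z\<in>?I. ?Y z $$ (r, s))" .
  qed (use K x y in \<open>auto intro!: ketbra_carrier smult_carrier_mat\<close>)
  then have "\<Phi> (ketbra x y) = sum_of_mats d2 (\<lambda>z. \<Phi> (?Y z)) ?I"
    using K by (simp add: linear_on_mats_sum[OF lin])
  then have "\<Phi> (ketbra x y) $$ (i, j) = (\<Sum>z\<in>?I. \<Phi> (?Y z) $$ (i, j))"
    using K ij by (simp add: sum_of_mats_index linear_on_mats_carrier[OF lin])
  also have "\<dots> = (\<Sum>z\<in>?I. a (fst z) * \<Phi> (ketbra (f (fst z)) (f (snd z))) $$ (i, j) * cnj (b (snd z)))"
  proof (rule sum.cong[OF refl])
    fix z assume z: "z \<in> ?I"
    show "\<Phi> (?Y z) $$ (i, j) = a (fst z) * \<Phi> (ketbra (f (fst z)) (f (snd z))) $$ (i, j) * cnj (b (snd z))"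
      using linear_on_mats_carrier[OF lin K[OF z]] ij
      by (simp add: linear_on_mats_smult[OF lin K[OF z]])
  qed
  also have "\<dots> = (\<Sum>l<k. \<Sum>m<k. a l * \<Phi> (ketbra (f l) (f m)) $$ (i, j) * cnj (b m))"
    by (simp add: sum.cartesian_product split_def)
  finally show ?thesis .
qed

text \<open>
  The vector \<open>w\<close> is \<open>\<Sum>\<^sub>p e\<^sub>p \<otimes> f\<^bsub>s p\<^esub>\<close>, so that the \<open>(p, q)\<close> block of \<open>|w\<rangle>\<langle>w|\<close> is
  \<open>|f\<^bsub>s p\<^esub>\<rangle>\<langle>f\<^bsub>s q\<^esub>|\<close>.
\<close>

lemma choi_principal_block_eq_ampliation:
  assumes lin: "linear_on_mats d1 d2 \<Phi>"
    and f: "\<And>p. p < k \<Longrightarrow> f (s p) \<in> carrier_vec d1"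
    and F: "\<And>p q. p < k \<Longrightarrow> q < k \<Longrightarrow> F (s p) (s q) = ketbra (f (s p)) (f (s q))"
  defines "w \<equiv> vec (k * d1) (\<lambda>i. f (s (i div d1)) $ (i mod d1))"
  shows "choi_principal_block k d2 F \<Phi> s = ampliation k d1 d2 \<Phi> (ketbra w w)"
proof -
  have wc: "w \<in> carrier_vec (k * d1)" by (simp add: w_def)
  have "vec d1 (\<lambda>x. w $ (p * d1 + x)) = f (s p)" if "p < k" for p
    using f[OF that] by (intro eq_vecI) (auto simp: w_def block_index that)
  then have "mat_block d1 (ketbra w w) p q = F (s p) (s q)" if "p < k" "q < k" for p q
    using that by (simp add: mat_block_ketbra[OF wc] F)
  then have blocks: "\<Phi> (mat_block d1 (ketbra w w) p q) = \<Phi> (F (s p) (s q))" if "p < k" "q < k" for p q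
    using that by simp
  have car: "\<Phi> (F (s p) (s q)) \<in> carrier_mat d2 d2" if "p < k" "q < k" for p q
    unfolding F[OF that] by (intro linear_on_mats_carrier[OF lin] ketbra_carrier f that)
  show ?thesis
    unfolding ampliation_eq_mat[OF lin]
    by (subst choi_principal_block_eq_mat) (auto intro!: eq_matI car simp: blocks block_index_split)
qed

text \<open>
  The hypothesis on leading blocks is used for one basis only, chosen according to \<open>w\<close>: one whose
  first \<open>k\<close> members have all components of \<open>w\<close> in their span.  Changing from these members to the components
  acts on the first tensor factor alone, as a congruence, and so preserves separability.
\<close>

lemma ampliation_ketbra_separable:
  assumes lin: "linear_on_mats d1 d2 \<Phi>" and pos: "k_positive k d1 d2 \<Phi>" and k: "k \<le> d1"
    and sep: "\<And>F. matrix_units d1 F \<Longrightarrow> separable k d2 (choi_principal_block k d2 F \<Phi> (\<lambda>p. p))"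
    and w: "w \<in> carrier_vec (k * d1)"
  shows "separable k d2 (ampliation k d1 d2 \<Phi> (ketbra w w))"
proof -
  define v where "v p = vec d1 (\<lambda>x. w $ (p * d1 + x))" for p
  obtain f a where ob: "orthonormal_basis d1 f"
    and va: "\<And>p x. p < k \<Longrightarrow> x < d1 \<Longrightarrow> v p $ x = (\<Sum>l<k. a p l * f l $ x)"
    using adapted_orthonormal_basis[OF k, of v] by blast
  define F where "F i j = ketbra (f i) (f j)" for i j
  have f: "f l \<in> carrier_vec d1" if "l < k" for l
    using orthonormal_basis_carrier[OF ob] that k by auto
  have "matrix_units d1 F" using ob by (auto simp: matrix_units_def F_def)
  from sep[OF this] obtain r A B where AB: "\<And>t. t < r \<Longrightarrow> psd k (A t)" "\<And>t. t < r \<Longrightarrow> psd d2 (B t)"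
    and C: "choi_principal_block k d2 F \<Phi> (\<lambda>p. p)
      = sum_of_mats (k * d2) (\<lambda>t. kronecker (A t) (B t)) {..<r::nat}"
    unfolding separable_def by blast
  have Ac: "A t \<in> carrier_mat k k" and Bc: "B t \<in> carrier_mat d2 d2" if "t < r" for t
    using AB[OF that] by (auto simp: psd_def)
  have \<Phi>F: "\<Phi> (F l m) \<in> carrier_mat d2 d2" if "l < k" "m < k" for l m
    unfolding F_def by (intro linear_on_mats_carrier[OF lin] ketbra_carrier f that)
  have entry: "\<Phi> (F l m) $$ (x, y) = (\<Sum>t<r. A t $$ (l, m) * B t $$ (x, y))"
    if "l < k" "m < k" "x < d2" "y < d2" for l m x y
  proof -
    have "\<Phi> (F l m) $$ (x, y) = choi_principal_block k d2 F \<Phi> (\<lambda>p. p) $$ (l * d2 + x, m * d2 + y)"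
      using that by (subst choi_principal_block_eq_mat) (simp_all add: block_index \<Phi>F)
    also have "\<dots> = (\<Sum>t<r. kronecker (A t) (B t) $$ (l * d2 + x, m * d2 + y))"
      unfolding C using that Ac Bc by (intro sum_of_mats_index) (auto simp: block_index)
    also have "\<dots> = (\<Sum>t<r. A t $$ (l, m) * B t $$ (x, y))"
      using that Ac Bc by (intro sum.cong refl) (simp add: kronecker_index[of _ k _ d2] block_index)
    finally show ?thesis .
  qed
  (* A' t is the congruence of A t by the coefficient matrix a. *)
  define A' where "A' t = mat k k (\<lambda>(p, q). \<Sum>l<k. \<Sum>m<k. a p l * A t $$ (l, m) * cnj (a q m))" for t
  have A': "psd k (A' t)" if "t < r" for t
    unfolding A'_def by (rule psd_congruence[OF AB(1)[OF that]])
  have P: "psd (k * d2) (ampliation k d1 d2 \<Phi> (ketbra w w))"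
    using pos psd_ketbra[OF w] by (simp add: k_positive_def)
  have "ampliation k d1 d2 \<Phi> (ketbra w w) = sum_of_mats (k * d2) (\<lambda>t. kronecker (A' t) (B t)) {..<r}"
  proof (rule eq_sum_of_matsI)
    fix i j assume ij: "i < k * d2" "j < k * d2"
    note s = block_index_split[OF ij(1)] block_index_split[OF ij(2)]
    let ?p = "i div d2" let ?q = "j div d2" let ?x = "i mod d2" let ?y = "j mod d2"
    have "ampliation k d1 d2 \<Phi> (ketbra w w) $$ (i, j) = \<Phi> (ketbra (v ?p) (v ?q)) $$ (?x, ?y)"
      using ij by (simp add: ampliation_eq_mat[OF lin] mat_block_ketbra[OF w s(1,3)] v_def)
    also have "\<dots> = (\<Sum>l<k. \<Sum>m<k. a ?p l * \<Phi> (ketbra (f l) (f m)) $$ (?x, ?y) * cnj (a ?q m))"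
      by (rule map_ketbra_expansion[OF lin f]) (use va s in \<open>auto simp: v_def\<close>)
    also have "\<dots> = (\<Sum>l<k. \<Sum>m<k. \<Sum>t<r. a ?p l * A t $$ (l, m) * cnj (a ?q m) * B t $$ (?x, ?y))"
      using s by (intro sum.cong refl)
        (simp add: entry flip: F_def, simp add: sum_distrib_left sum_distrib_right mult_ac)
    also have "\<dots> = (\<Sum>l<k. \<Sum>t<r. \<Sum>m<k. a ?p l * A t $$ (l, m) * cnj (a ?q m) * B t $$ (?x, ?y))"
      by (intro sum.cong refl sum.swap)
    also have "\<dots> = (\<Sum>t<r. \<Sum>l<k. \<Sum>m<k. a ?p l * A t $$ (l, m) * cnj (a ?q m) * B t $$ (?x, ?y))"
      by (rule sum.swap)
    also have "\<dots> = (\<Sum>t<r. kronecker (A' t) (B t) $$ (i, j))"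
    proof (intro sum.cong refl)
      fix t assume "t \<in> {..<r}"
      then have "kronecker (A' t) (B t) $$ (i, j) = A' t $$ (?p, ?q) * B t $$ (?x, ?y)"
        using ij Bc by (intro kronecker_index) (auto simp: A'_def)
      then show "(\<Sum>l<k. \<Sum>m<k. a ?p l * A t $$ (l, m) * cnj (a ?q m) * B t $$ (?x, ?y))
        = kronecker (A' t) (B t) $$ (i, j)"
        using s by (simp add: A'_def sum_distrib_right)
    qed
    finally show "ampliation k d1 d2 \<Phi> (ketbra w w) $$ (i, j) = (\<Sum>t<r. kronecker (A' t) (B t) $$ (i, j))" .
  qed (use Bc P in \<open>auto simp: A'_def psd_def\<close>)
  then show ?thesis
    using A' AB(2) by (intro separable_finite_sumI[OF _ _ _ P]) auto
qed

theorem theorem3p8: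
  fixes d1 d2 k :: nat and \<Phi> :: "complex mat \<Rightarrow> complex mat"
  assumes "1 \<le> k" and "k \<le> d1"
    and "linear_on_mats d1 d2 \<Phi>"
    and "k_positive k d1 d2 \<Phi>"
  shows "(k_entanglement_breaking k d1 d2 \<Phi> \<longleftrightarrow>
            (\<forall>F. matrix_units d1 F \<longrightarrow>
               (\<forall>s. (\<forall>p<k. s p < d1) \<longrightarrow> separable k d2 (choi_principal_block k d2 F \<Phi> s))))
       \<and> (k_entanglement_breaking k d1 d2 \<Phi> \<longleftrightarrow>
            (\<forall>F. matrix_units d1 F \<longrightarrow> separable k d2 (choi_principal_block k d2 F \<Phi> (\<lambda>p. p))))"
    (is "(?i \<longleftrightarrow> ?ii) \<and> (?i \<longleftrightarrow> ?iii)")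
proof -
  have "?ii" if eb: ?i
  proof (intro allI impI)
    fix F s assume "matrix_units d1 F" and s: "\<forall>p<k. s p < d1"
    then obtain f where f: "orthonormal_basis d1 f" "\<forall>i<d1. \<forall>j<d1. F i j = ketbra (f i) (f j)"
      by (auto simp: matrix_units_def)
    define w where "w = vec (k * d1) (\<lambda>i. f (s (i div d1)) $ (i mod d1))"
    have "choi_principal_block k d2 F \<Phi> s = ampliation k d1 d2 \<Phi> (ketbra w w)"
      unfolding w_def using f s
      by (intro choi_principal_block_eq_ampliation[OF assms(3)]) (auto intro: orthonormal_basis_carrier)
    moreover have "psd (k * d1) (ketbra w w)"
      by (rule psd_ketbra) (simp add: w_def)
    ultimately show "separable k d2 (choi_principal_block k d2 F \<Phi> s)"
      using eb by (simp add: k_entanglement_breaking_def)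
  qed
  moreover have "?iii" if ?ii
    using that assms(2) by auto
  moreover have "?i" if iii: ?iii
    unfolding k_entanglement_breaking_def
  proof (intro conjI allI impI)
    fix X assume "psd (k * d1) X"
    then obtain r :: nat and w where w: "\<And>i. i < r \<Longrightarrow> w i \<in> carrier_vec (k * d1)"
      and X: "X = sum_of_mats (k * d1) (\<lambda>i. ketbra (w i) (w i)) {..<r}"
      using psd_sum_of_ketbras by blast
    have "ampliation k d1 d2 \<Phi> X
      = sum_of_mats (k * d2) (\<lambda>i. ampliation k d1 d2 \<Phi> (ketbra (w i) (w i))) {..<r}"
      unfolding X using w by (intro ampliation_sum[OF assms(3)]) (auto intro: ketbra_carrier)
    also have "separable k d2 \<dots>"
      using ampliation_ketbra_separable[OF assms(3,4,2)] iii w by (intro separable_sum) auto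
    finally show "separable k d2 (ampliation k d1 d2 \<Phi> X)" .
  qed (rule assms(4))
  ultimately show ?thesis by blast
qed

end
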